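(* For the algorithm dist-EF-SGD (described in the context), there exist a loss function $\mathcal L$ with Assumptions 1, 2, 3 of the context satisfied for some constants $L,\sigma,\omega$, an initial point $x_0$, a number of workers $M$, learning rates with $\eta_{-1}=0$ and $\{\eta_t\}_{t\ge0}$ positive and decreasing, a number $\delta\in(0,1)$ and a $\delta$-compressor $\mathcal C$, and a step $t$, such that, with $G^2=\sigma^2+\omega^2$, $$\mathbf E\left[\left\lVert\tilde e_t+\frac1M\sum_{i=1}^M e_{t,i}\right\rVert^2\right]>\frac{8(1-\delta)G^2}{\delta^2}\left(1+\frac{16}{\delta^2}\right).$$
   Context: $\lVert\cdot\rVert$ is the Euclidean norm on $\mathbb R^d$. Compressor: a (possibly randomized) operator $\mathcal C:\mathbb R^d\to\mathbb R^d$ is a $\delta$-compressor, $\delta\in(0,1)$, if $\mathbf E_{\mathcal C}\lVert\mathcal C(x)-x\rVert^2\le(1-\delta)\lVert x\rVert^2$ for all $x\in\mathbb R^d$, the expectation being over the randomness of $\mathcal C$. Loss: given a loss function $\mathcal L(x,\xi)$, $f(x)=\mathbf E_\xi[\mathcal L(x,\xi)]$, where $x\in\mathbb R^d$ and $\xi$ is a data batch drawn from some distribution. Algorithm dist-EF-SGD. Inputs: $\mathcal L$, learning rates $\{\eta_t\}$ with $\eta_{-1}=0$, number of workers $M$, compressor $\mathcal C$. Initialize $x_0\in\mathbb R^d$, $e_{0,i}=0\in\mathbb R^d$ for each worker $i=1,\dots,M$, and $\tilde e_0=0\in\mathbb R^d$ on the server. For $t=0,1,2,\dots$: each worker $i$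 picks data $\xi_{t,i}$ and computes $g_{t,i}=\nabla\mathcal L(x_t,\xi_{t,i})$ (gradient in $x$), $p_{t,i}=g_{t,i}+\frac{\eta_{t-1}}{\eta_t}e_{t,i}$, $\Delta_{t,i}=\mathcal C(p_{t,i})$, $e_{t+1,i}=p_{t,i}-\Delta_{t,i}$; the server computes $\tilde p_t=\frac1M\sum_{i=1}^M\Delta_{t,i}+\frac{\eta_{t-1}}{\eta_t}\tilde e_t$, $\tilde\Delta_t=\mathcal C(\tilde p_t)$, $\tilde e_{t+1}=\tilde p_t-\tilde\Delta_t$; and all workers update $x_{t+1}=x_t-\eta_t\tilde\Delta_t$. $\mathbf E_t$ denotes expectation at iteration $t$, i.e. conditional on everything that happened before iteration $t$; $\mathbf E$ is total expectation. Assumption 1: $f$ is lower-bounded, $\inf_{x\in\mathbb R^d}f(x)>-\infty$, and $L$-smooth: $f$ is differentiable and $\lVert\nabla f(x)-\nabla f(y)\rVert\le L\lVert x-y\rVert$ for all $x,y\in\mathbb R^d$, for a constant $L\ge0$. Assumption 2: $\mathbf E_t[g_{t,i}]=\nabla f(x_t)$ and $\mathbf E_t[\lVert g_{t,i}-\nabla f(x_t)\rVert^2]\le\sigma^2$ for all $t,i$. Assumption 3: $\lVert\nabla f(x_t)\rVert^2\le\omega^2$ for all $t$. *)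

theory Defs
  imports "HOL-Probability.Probability"
begin

definition gradient :: "('v::real_inner \<Rightarrow> real) \<Rightarrow> 'v \<Rightarrow> 'v" where
  "gradient h x = (THE D. GDERIV h x :> D)"

text \<open>
  A loss \<open>Ls x \<xi>\<close> whose batch \<open>\<xi>\<close> has distribution \<open>D\<close>, and the risk, its expectation over \<open>\<xi>\<close>.
\<close>

definition loss_function ::
    "'x measure \<Rightarrow> ('v::real_inner \<Rightarrow> 'x \<Rightarrow> real) \<Rightarrow> bool" where
  "loss_function D Ls \<longleftrightarrow> prob_space D
     \<and> (\<forall>x. integrable D (Ls x))
     \<and> (\<forall>\<xi>\<in>space D. \<forall>x. (\<lambda>y. Ls y \<xi>) differentiable (at x))"

definition risk :: "'x measure \<Rightarrow> ('v \<Rightarrow> 'x \<Rightarrow> real) \<Rightarrow> 'v \<Rightarrow> real" where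
  "risk D Ls x = (\<integral>\<xi>. Ls x \<xi> \<partial>D)"

text \<open>
  A randomized operator is a jointly measurable map \<open>C s x\<close> of a random seed \<open>s\<close> with
  distribution \<open>Q\<close> and the argument \<open>x\<close>. Integrability is required explicitly because the
  Bochner integral of a non-integrable function is 0.
\<close>

definition compressor ::
    "real \<Rightarrow> 's measure \<Rightarrow> ('s \<Rightarrow> 'v::euclidean_space \<Rightarrow> 'v) \<Rightarrow> bool" where
  "compressor \<delta> Q C \<longleftrightarrow> 0 < \<delta> \<and> \<delta> < 1 \<and> prob_space Q
     \<and> (\<lambda>(s, x). C s x) \<in> borel_measurable (Q \<Otimes>\<^sub>M borel)
     \<and> (\<forall>x. integrable Q (\<lambda>s. (norm (C s x - x))\<^sup>2)
          \<and> (\<integral>s. (norm (C s x - x))\<^sup>2 \<partial>Q) \<le> (1 - \<delta>) * (norm x)\<^sup>2)"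

text \<open>
  A sample point \<open>\<omega>\<close> is a pair: \<open>fst \<omega> (t, i)\<close> is the batch of worker \<open>i \<in> {1..M}\<close> at
  iteration \<open>t\<close>, and \<open>snd \<omega> (t, j)\<close> is the seed of the compression done at iteration \<open>t\<close> by
  worker \<open>j \<in> {1..M}\<close> or, for \<open>j = 0\<close>, by the server. All of these are independent.
\<close>

type_synonym ('x, 's) sample = "(nat \<times> nat \<Rightarrow> 'x) \<times> (nat \<times> nat \<Rightarrow> 's)"

definition sample_space ::
    "nat \<Rightarrow> 'x measure \<Rightarrow> 's measure \<Rightarrow> ('x, 's) sample measure" where
  "sample_space M D Q =
     PiM (UNIV \<times> {1..M}) (\<lambda>_. D) \<Otimes>\<^sub>M PiM (UNIV \<times> {0..M}) (\<lambda>_. Q)"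

text \<open>The \<open>\<sigma>\<close>-algebra generated by all batches and seeds of the iterations before \<open>t\<close>.\<close>

definition past ::
    "nat \<Rightarrow> 'x measure \<Rightarrow> 's measure \<Rightarrow> nat \<Rightarrow> ('x, 's) sample measure" where
  "past M D Q t = vimage_algebra (space (sample_space M D Q))
     (\<lambda>(\<xi>, s). (restrict \<xi> ({..<t} \<times> {1..M}), restrict s ({..<t} \<times> {0..M})))
     (PiM ({..<t} \<times> {1..M}) (\<lambda>_. D) \<Otimes>\<^sub>M PiM ({..<t} \<times> {0..M}) (\<lambda>_. Q))"

text \<open>The variables \<open>x\<^sub>t\<close>, \<open>e\<^sub>t\<^sub>,\<^sub>i\<close> (as a function of \<open>i\<close>) and the server error.\<close>

record 'v state =
  iterate :: 'v
  worker_err :: "nat \<Rightarrow> 'v"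
  server_err :: 'v

text \<open>The learning rates are indexed by integers because the algorithm uses \<open>\<eta> (-1)\<close>.\<close>

definition ef_sgd_step ::
    "('v::real_inner \<Rightarrow> 'x \<Rightarrow> real) \<Rightarrow> ('s \<Rightarrow> 'v \<Rightarrow> 'v) \<Rightarrow> nat \<Rightarrow> (int \<Rightarrow> real)
     \<Rightarrow> ('x, 's) sample \<Rightarrow> nat \<Rightarrow> 'v state \<Rightarrow> 'v state" where
  "ef_sgd_step Ls C M \<eta> \<omega> t S =
     (let r = \<eta> (int t - 1) / \<eta> (int t);
          g = (\<lambda>i. gradient (\<lambda>y. Ls y (fst \<omega> (t, i))) (iterate S));
          p = (\<lambda>i. g i + r *\<^sub>R worker_err S i);
          \<Delta> = (\<lambda>i. C (snd \<omega> (t, i)) (p i));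
          ps = (1 / real M) *\<^sub>R (\<Sum>i=1..M. \<Delta> i) + r *\<^sub>R server_err S;
          \<Delta>s = C (snd \<omega> (t, 0)) ps
      in \<lparr> iterate = iterate S - \<eta> (int t) *\<^sub>R \<Delta>s,
           worker_err = (\<lambda>i. p i - \<Delta> i),
           server_err = ps - \<Delta>s \<rparr>)"

primrec ef_sgd ::
    "('v::real_inner \<Rightarrow> 'x \<Rightarrow> real) \<Rightarrow> ('s \<Rightarrow> 'v \<Rightarrow> 'v) \<Rightarrow> nat \<Rightarrow> (int \<Rightarrow> real) \<Rightarrow> 'v
     \<Rightarrow> ('x, 's) sample \<Rightarrow> nat \<Rightarrow> 'v state" where
  "ef_sgd Ls C M \<eta> x0 \<omega> 0 = \<lparr> iterate = x0, worker_err = (\<lambda>_. 0), server_err = 0 \<rparr>"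
| "ef_sgd Ls C M \<eta> x0 \<omega> (Suc t) = ef_sgd_step Ls C M \<eta> \<omega> t (ef_sgd Ls C M \<eta> x0 \<omega> t)"

definition stochastic_gradient ::
    "('v::real_inner \<Rightarrow> 'x \<Rightarrow> real) \<Rightarrow> ('s \<Rightarrow> 'v \<Rightarrow> 'v) \<Rightarrow> nat \<Rightarrow> (int \<Rightarrow> real) \<Rightarrow> 'v
     \<Rightarrow> ('x, 's) sample \<Rightarrow> nat \<Rightarrow> nat \<Rightarrow> 'v" where
  "stochastic_gradient Ls C M \<eta> x0 \<omega> t i =
     gradient (\<lambda>y. Ls y (fst \<omega> (t, i))) (iterate (ef_sgd Ls C M \<eta> x0 \<omega> t))"

definition vec_cond_exp ::
    "'w measure \<Rightarrow> 'w measure \<Rightarrow> ('w \<Rightarrow> real ^ 'n) \<Rightarrow> 'w \<Rightarrow> real ^ 'n" where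
  "vec_cond_exp P F X \<omega> = (\<chi> k. real_cond_exp P F (\<lambda>\<omega>'. X \<omega>' $ k) \<omega>)"

definition assumption1 :: "real \<Rightarrow> ('v::real_inner \<Rightarrow> real) \<Rightarrow> bool" where
  "assumption1 L f \<longleftrightarrow> bdd_below (range f)
     \<and> (\<forall>x. f differentiable (at x))
     \<and> L-lipschitz_on UNIV (gradient f)"

definition assumption2 ::
    "real \<Rightarrow> 'x measure \<Rightarrow> (real ^ 'n \<Rightarrow> 'x \<Rightarrow> real) \<Rightarrow> 's measure
     \<Rightarrow> ('s \<Rightarrow> real ^ 'n \<Rightarrow> real ^ 'n) \<Rightarrow> nat \<Rightarrow> (int \<Rightarrow> real) \<Rightarrow> real ^ 'n \<Rightarrow> bool" where
  "assumption2 \<sigma> D Ls Q C M \<eta> x0 \<longleftrightarrow>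
     (let P = sample_space M D Q;
          g = (\<lambda>t i \<omega>. stochastic_gradient Ls C M \<eta> x0 \<omega> t i);
          df = (\<lambda>t \<omega>. gradient (risk D Ls) (iterate (ef_sgd Ls C M \<eta> x0 \<omega> t)))
      in \<forall>t. \<forall>i\<in>{1..M}.
           integrable P (g t i)
         \<and> integrable P (\<lambda>\<omega>. (norm (g t i \<omega> - df t \<omega>))\<^sup>2)
         \<and> (AE \<omega> in P. vec_cond_exp P (past M D Q t) (g t i) \<omega> = df t \<omega>)
         \<and> (AE \<omega> in P. real_cond_exp P (past M D Q t)
                            (\<lambda>\<omega>. (norm (g t i \<omega> - df t \<omega>))\<^sup>2) \<omega> \<le> \<sigma>\<^sup>2))"

definition assumption3 ::
    "real \<Rightarrow> 'x measure \<Rightarrow> ('v::real_inner \<Rightarrow> 'x \<Rightarrow> real) \<Rightarrow> 's measure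
     \<Rightarrow> ('s \<Rightarrow> 'v \<Rightarrow> 'v) \<Rightarrow> nat \<Rightarrow> (int \<Rightarrow> real) \<Rightarrow> 'v \<Rightarrow> bool" where
  "assumption3 w D Ls Q C M \<eta> x0 \<longleftrightarrow>
     (\<forall>t. AE \<omega> in sample_space M D Q.
        (norm (gradient (risk D Ls) (iterate (ef_sgd Ls C M \<eta> x0 \<omega> t))))\<^sup>2 \<le> w\<^sup>2)"

definition learning_rates :: "(int \<Rightarrow> real) \<Rightarrow> bool" where
  "learning_rates \<eta> \<longleftrightarrow> \<eta> (-1) = 0 \<and> (\<forall>t\<ge>0. 0 < \<eta> t) \<and> strict_antimono_on {0..} \<eta>"

end

theory Submission
  imports Defs
begin

text \<open>
  The error recursion carries the factor \<open>\<eta> (t - 1) / \<eta> t\<close>. For decreasing learning rates this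
  factor exceeds 1 and may be arbitrarily large, whereas the claimed bound depends only on
  \<open>\<delta>\<close>, \<open>\<sigma>\<close> and \<open>w\<close>. A single quick drop of the learning rate therefore blows the
  error up, already without any randomness.

  Concretely, let \<open>b\<close> be a unit vector, \<open>f x = sin (x \<bullet> b)\<close> and \<open>x\<^sub>0 = 0\<close>. The gradient
  \<open>cos (x \<bullet> b) b\<close> is bounded by 1 everywhere, so \<open>w = 1\<close> works for whatever
  learning rates are chosen, and it equals \<open>b\<close> at the start. One worker sees the exact loss
  (\<open>\<sigma> = 0\<close>), and the compressor is \<open>x \<mapsto> x / 2\<close>, for which \<open>\<delta> = 1 / 2\<close> is
  admissible. The combined error after two steps is
  \<open>(r / 2) g\<^sub>0 + (3 / 4) g\<^sub>1\<close> with \<open>r = \<eta> 0 / \<eta> 1\<close>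
  (lemma \<open>halving_error_after_two_steps\<close>), of norm at least \<open>r / 2 - 3 / 4\<close>. The bound
  has the value 1040, and \<open>\<eta> t = 100 powi (-t)\<close> gives \<open>r = 100\<close>.
\<close>

lemma gradient_eqI:
  assumes "GDERIV h x :> D"
  shows "gradient h x = D"
  unfolding gradient_def
proof (rule the_equality)
  show "GDERIV h x :> D" by (rule assms)
next
  fix E assume "GDERIV h x :> E"
  then have "(\<lambda>v. v \<bullet> E) = (\<lambda>v. v \<bullet> D)"
    using has_derivative_unique assms unfolding gderiv_def by blast
  then show "E = D"
    by (metis vector_eq_ldot)
qed

lemma GDERIV_sin_inner: "GDERIV (\<lambda>y. sin (y \<bullet> b)) x :> cos (x \<bullet> b) *\<^sub>R b"
  unfolding gderiv_def by (auto intro!: derivative_eq_intros simp: mult.commute)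

lemma gradient_sin_inner: "gradient (\<lambda>y. sin (y \<bullet> b)) x = cos (x \<bullet> b) *\<^sub>R b"
  by (rule gradient_eqI[OF GDERIV_sin_inner])

lemma sin_inner_differentiable: "(\<lambda>y. sin (y \<bullet> b)) differentiable (at x)"
  using GDERIV_sin_inner[of b x] unfolding gderiv_def differentiable_def by blast

lemma assumption1_sin_inner:
  fixes b :: "'v::real_inner"
  assumes "norm b = 1"
  shows "assumption1 1 (\<lambda>x. sin (x \<bullet> b))"
proof -
  have "bdd_below (range (\<lambda>x::'v. sin (x \<bullet> b)))"
    by (rule bdd_belowI[of _ "-1"]) auto
  moreover have "1-lipschitz_on UNIV (gradient (\<lambda>y. sin (y \<bullet> b)))"
  proof (rule lipschitz_onI)
    fix x y :: 'v
    have "dist (cos (x \<bullet> b) *\<^sub>R b) (cos (y \<bullet> b) *\<^sub>R b) = \<bar>cos (x \<bullet> b) - cos (y \<bullet> b)\<bar>"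
      using assms by (simp add: dist_norm flip: scaleR_left_diff_distrib)
    also have "\<dots> \<le> 1 * \<bar>x \<bullet> b - y \<bullet> b\<bar>"
      using field_differentiable_bound[of UNIV cos "\<lambda>z. - sin z" 1 "x \<bullet> b" "y \<bullet> b"]
      by (auto intro!: derivative_eq_intros)
    also have "\<dots> = \<bar>(x - y) \<bullet> b\<bar>"
      by (simp add: inner_diff_left)
    also have "\<dots> \<le> norm (x - y)"
      using Cauchy_Schwarz_ineq2[of "x - y" b] assms by simp
    finally show "dist (gradient (\<lambda>y. sin (y \<bullet> b)) x) (gradient (\<lambda>y. sin (y \<bullet> b)) y)
        \<le> 1 * dist x y"
      by (simp add: gradient_sin_inner dist_norm)
  qed simp
  ultimately show ?thesis
    unfolding assumption1_def using sin_inner_differentiable by blast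
qed

lemma risk_deterministic:
  assumes "prob_space D"
  shows "risk D (\<lambda>x _. f x) = f"
proof -
  interpret prob_space D by fact
  show ?thesis by (simp add: risk_def fun_eq_iff prob_space)
qed

lemma prob_space_sample_space:
  assumes "prob_space D" "prob_space Q"
  shows "prob_space (sample_space M D Q)"
  unfolding sample_space_def
  by (intro prob_space_pair prob_space_PiM assms)

lemma subalgebra_past: "subalgebra (sample_space M D Q) (past M D Q t)"
proof -
  let ?R = "\<lambda>(\<xi>, s). (restrict \<xi> ({..<t} \<times> {1..M}), restrict s ({..<t} \<times> {0..M}))"
  let ?N = "PiM ({..<t} \<times> {1..M}) (\<lambda>_. D) \<Otimes>\<^sub>M PiM ({..<t} \<times> {0..M}) (\<lambda>_. Q)"
  have [measurable]:
    "(\<lambda>\<xi>. restrict \<xi> ({..<t} \<times> {1..M})) \<in>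
       measurable (PiM (UNIV \<times> {1..M}) (\<lambda>_. D)) (PiM ({..<t} \<times> {1..M}) (\<lambda>_. D))"
    "(\<lambda>s. restrict s ({..<t} \<times> {0..M})) \<in>
       measurable (PiM (UNIV \<times> {0..M}) (\<lambda>_. Q)) (PiM ({..<t} \<times> {0..M}) (\<lambda>_. Q))"
    by (rule measurable_restrict_subset; auto)+
  have "?R \<in> measurable (sample_space M D Q) ?N"
    unfolding sample_space_def case_prod_beta by measurable
  then have "sets (past M D Q t) \<subseteq> sets (sample_space M D Q)"
    unfolding past_def by (rule sets_image_in_sets[OF refl])
  then show ?thesis
    unfolding subalgebra_def by (simp add: past_def)
qed

lemma ef_sgd_deterministic:
  "ef_sgd (\<lambda>x _. f x) (\<lambda>_. C) M \<eta> x0 \<omega> t = ef_sgd (\<lambda>x _. f x) (\<lambda>_. C) M \<eta> x0 \<omega>' t"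
  by (induction t) (simp_all add: ef_sgd_step_def)

text \<open>
  Without randomness the trajectory is constant on the sample space, and constants are measurable
  with respect to the past, so that they are their own conditional expectations.
\<close>

lemma assumption2_deterministic:
  fixes f :: "real ^ 'n \<Rightarrow> real" and D :: "'x measure" and Q :: "'s measure"
  assumes "prob_space D" "prob_space Q"
  shows "assumption2 0 D (\<lambda>x _. f x) Q (\<lambda>_. C) M \<eta> x0"
proof -
  define P where "P = sample_space M D Q"
  define x where "x = (\<lambda>t. iterate (ef_sgd (\<lambda>x _. f x) (\<lambda>_. C) M \<eta> x0
    (undefined :: ('x, 's) sample) t))"
  have x: "iterate (ef_sgd (\<lambda>x _. f x) (\<lambda>_. C) M \<eta> x0 \<omega> t) = x t"
    for t and \<omega> :: "('x, 's) sample"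
    unfolding x_def by (subst ef_sgd_deterministic[where \<omega>' = undefined]) simp
  interpret P: prob_space P
    unfolding P_def by (rule prob_space_sample_space[OF assms])
  have const: "AE \<omega> in P. real_cond_exp P (past M D Q t) (\<lambda>_. c) \<omega> = c" for t and c :: real
  proof -
    interpret finite_measure_subalgebra P "past M D Q t"
      by unfold_locales (simp add: P_def subalgebra_past)
    show ?thesis by (rule real_cond_exp_F_meas) auto
  qed
  have "AE \<omega> in P. vec_cond_exp P (past M D Q t) (\<lambda>_. v) \<omega> = v" for t and v :: "real ^ 'n"
  proof -
    have "AE \<omega> in P. \<forall>k\<in>UNIV. real_cond_exp P (past M D Q t) (\<lambda>_. v $ k) \<omega> = v $ k"
      using const by (intro AE_finite_allI) auto
    then show ?thesis
      by eventually_elim (simp add: vec_cond_exp_def vec_eq_iff)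
  qed
  moreover have "AE \<omega> in P. real_cond_exp P (past M D Q t) (\<lambda>_. 0) \<omega> \<le> 0" for t
    using const[of t 0] by eventually_elim simp
  ultimately show ?thesis
    unfolding assumption2_def Let_def stochastic_gradient_def x risk_deterministic[OF assms(1)] P_def[symmetric]
    by simp
qed

lemma compressor_halving:
  assumes "prob_space Q"
  shows "compressor (1 / 2) Q (\<lambda>_ x :: 'v::euclidean_space. (1 / 2) *\<^sub>R x)"
proof -
  interpret prob_space Q by fact
  have "(1 / 2) *\<^sub>R x - x = (- 1 / 2) *\<^sub>R x" for x :: 'v
    by (simp add: scaleR_left_diff_distrib[of "1 / 2" 1 x, simplified, symmetric])
  then have *: "(norm ((1 / 2) *\<^sub>R x - x))\<^sup>2 = (norm x)\<^sup>2 / 4" for x :: 'v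
    by (simp add: power_divide)
  show ?thesis
    unfolding compressor_def * using assms by (simp add: prob_space)
qed

lemma learning_rates_geometric:
  "learning_rates (\<lambda>t. if t < 0 then 0 else (1 / 100) ^ nat t)"
  unfolding learning_rates_def monotone_on_def
  by (auto intro!: power_strict_decreasing)

text \<open>
  The first step leaves the worker with \<open>g\<^sub>0 / 2\<close> and the server with \<open>g\<^sub>0 / 4\<close>. In the second
  step both are multiplied by \<open>r = \<eta> 0 / \<eta> 1\<close>; the worker's share \<open>p = g\<^sub>1 + (r / 2) g\<^sub>0\<close>
  survives with weight \<open>1 / 2\<close> at the worker and \<open>1 / 4\<close> at the server, the server's own
  share with weight \<open>1 / 2\<close>.
\<close>

lemma halving_error_after_two_steps:
  fixes f :: "'v::real_inner \<Rightarrow> real" and x0 :: 'v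
  assumes "\<eta> (- 1) = 0"
  defines "S \<equiv> \<lambda>\<omega>. ef_sgd (\<lambda>x _. f x) (\<lambda>_ x. (1 / 2) *\<^sub>R x) 1 \<eta> x0 \<omega> 2"
  defines "g0 \<equiv> gradient f x0"
  defines "g1 \<equiv> gradient f (x0 - (\<eta> 0 / 4) *\<^sub>R g0)"
  shows "server_err (S \<omega>) + (1 / real 1) *\<^sub>R (\<Sum>i=1..1. worker_err (S \<omega>) i)
       = (\<eta> 0 / \<eta> 1 / 2) *\<^sub>R g0 + (3 / 4) *\<^sub>R g1"
proof -
  have half: "v - (1 / 2) *\<^sub>R v = (1 / 2) *\<^sub>R v" for v :: 'v
    using scaleR_left_diff_distrib[of 1 "1 / 2" v] by simp
  have S: "S \<omega> = ef_sgd_step (\<lambda>x _. f x) (\<lambda>_ x. (1 / 2) *\<^sub>R x) 1 \<eta> \<omega> 1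
      (ef_sgd_step (\<lambda>x _. f x) (\<lambda>_ x. (1 / 2) *\<^sub>R x) 1 \<eta> \<omega> 0
        \<lparr> iterate = x0, worker_err = (\<lambda>_. 0), server_err = 0 \<rparr>)"
    unfolding S_def by (simp add: numeral_2_eq_2)
  define r where "r = \<eta> 0 / \<eta> 1"
  have "server_err (S \<omega>) + (1 / real 1) *\<^sub>R (\<Sum>i=1..1. worker_err (S \<omega>) i)
      = (1 / 2) *\<^sub>R ((1 / 2) *\<^sub>R (g1 + r *\<^sub>R (1 / 2) *\<^sub>R g0) + r *\<^sub>R (1 / 4) *\<^sub>R g0)
        + (1 / 2) *\<^sub>R (g1 + r *\<^sub>R (1 / 2) *\<^sub>R g0)"
    unfolding S ef_sgd_step_def Let_def half g1_def
    by (simp add: half assms(1) flip: r_def g0_def)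
  also have "\<dots> = (1 / 4 + 1 / 2) *\<^sub>R g1 + (r / 8 + r / 8 + r / 4) *\<^sub>R g0"
    unfolding scaleR_add_left by (simp add: scaleR_add_right)
  finally show ?thesis by (simp add: r_def add.commute)
qed

theorem claim1:
  shows "\<exists>(D :: real measure) (Ls :: real ^ 'n \<Rightarrow> real \<Rightarrow> real)
           (Q :: real measure) (C :: real \<Rightarrow> real ^ 'n \<Rightarrow> real ^ 'n)
           (L :: real) (\<sigma> :: real) (w :: real) (x0 :: real ^ 'n) (M :: nat)
           (\<eta> :: int \<Rightarrow> real) (\<delta> :: real) (t :: nat).
      loss_function D Ls \<and> compressor \<delta> Q C \<and> 1 \<le> M \<and> learning_rates \<eta>
    \<and> 0 \<le> L \<and> 0 \<le> \<sigma> \<and> 0 \<le> w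
    \<and> assumption1 L (risk D Ls)
    \<and> assumption2 \<sigma> D Ls Q C M \<eta> x0
    \<and> assumption3 w D Ls Q C M \<eta> x0
    \<and> (\<integral>\<omega>. (norm (server_err (ef_sgd Ls C M \<eta> x0 \<omega> t)
              + (1 / real M) *\<^sub>R (\<Sum>i=1..M. worker_err (ef_sgd Ls C M \<eta> x0 \<omega> t) i)))\<^sup>2
         \<partial>sample_space M D Q)
      > 8 * (1 - \<delta>) * (\<sigma>\<^sup>2 + w\<^sup>2) / \<delta>\<^sup>2 * (1 + 16 / \<delta>\<^sup>2)"
proof -
  define D :: "real measure" where "D = return borel 0"
  obtain b :: "real ^ 'n" where b: "norm b = 1"
    using vector_choose_size zero_le_one by blast
  define f where "f = (\<lambda>x. sin (x \<bullet> b))"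
  define C where "C = (\<lambda>(_::real) x :: real ^ 'n. (1 / 2) *\<^sub>R x)"
  define \<eta> :: "int \<Rightarrow> real" where "\<eta> = (\<lambda>t. if t < 0 then 0 else (1 / 100) ^ nat t)"
  have D: "prob_space D"
    unfolding D_def by (rule prob_space_return) simp
  interpret D: prob_space D by (rule D)
  interpret P: prob_space "sample_space 1 D D"
    by (rule prob_space_sample_space[OF D D])
  have grad: "gradient f x = cos (x \<bullet> b) *\<^sub>R b" for x
    unfolding f_def by (rule gradient_sin_inner)
  have "loss_function D (\<lambda>x _. f x)"
    unfolding loss_function_def f_def using D sin_inner_differentiable by auto
  moreover have "compressor (1 / 2) D C"
    unfolding C_def by (rule compressor_halving[OF D])
  moreover have "learning_rates \<eta>"
    unfolding \<eta>_def by (rule learning_rates_geometric)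
  moreover have "assumption1 1 (risk D (\<lambda>x _. f x))"
    unfolding risk_deterministic[OF D] f_def by (rule assumption1_sin_inner[OF b])
  moreover have "assumption2 0 D (\<lambda>x _. f x) D C 1 \<eta> 0"
    unfolding C_def by (rule assumption2_deterministic[OF D D])
  moreover have "assumption3 1 D (\<lambda>x _. f x) D C 1 \<eta> 0"
    unfolding assumption3_def risk_deterministic[OF D] grad
    by (simp add: b abs_square_le_1)
  moreover have "(\<integral>\<omega>. (norm (server_err (ef_sgd (\<lambda>x _. f x) C 1 \<eta> 0 \<omega> 2)
              + (1 / real 1) *\<^sub>R (\<Sum>i=1..1. worker_err (ef_sgd (\<lambda>x _. f x) C 1 \<eta> 0 \<omega> 2) i)))\<^sup>2
         \<partial>sample_space 1 D D)
      > 8 * (1 - 1 / 2) * (0\<^sup>2 + 1\<^sup>2) / (1 / 2)\<^sup>2 * (1 + 16 / (1 / 2)\<^sup>2)"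
  proof -
    \<comment> \<open>The second gradient is taken at \<open>x\<^sub>1 = - b / 4\<close>, whence the argument of the cosine.\<close>
    define a where "a = 50 + 3 / 4 * cos (1 / 4 :: real)"
    have bb: "b \<bullet> b = 1"
      using b by (simp add: norm_eq_1)
    have err: "server_err (ef_sgd (\<lambda>x _. f x) C 1 \<eta> 0 \<omega> 2)
        + (1 / real 1) *\<^sub>R (\<Sum>i=1..1. worker_err (ef_sgd (\<lambda>x _. f x) C 1 \<eta> 0 \<omega> 2) i) = a *\<^sub>R b"
      for \<omega> :: "(real, real) sample"
      unfolding C_def
      by (subst halving_error_after_two_steps)
         (simp_all add: \<eta>_def grad bb a_def scaleR_add_left)
    have "cos (1 / 4 :: real) \<ge> - 1"
      by simp
    then have "a \<ge> 49"
      unfolding a_def by linarith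
    then have "49\<^sup>2 \<le> a\<^sup>2"
      by (intro power_mono) auto
    then show ?thesis
      unfolding err by (simp add: b P.prob_space[unfolded One_nat_def] power2_eq_square)
  qed
  ultimately show ?thesis
    by - (rule exI[of _ D], rule exI[of _ "\<lambda>x _. f x"], rule exI[of _ D], rule exI[of _ C],
        rule exI[of _ 1], rule exI[of _ 0], rule exI[of _ 1], rule exI[of _ 0], rule exI[of _ 1],
        rule exI[of _ \<eta>], rule exI[of _ "1 / 2"], rule exI[of _ 2],
        intro conjI; (assumption | simp (no_asm)))
qed

end
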